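(* Let $q\geq 5$ be a prime power. Then $t_v(2,q)\geq \lceil t_0\rceil$, where $t_0$ is the smallest real positive solution of the inequality $$\binom{t_0}{5}(q-4)+\binom{t_0}{2}(q-1)+t_0\geq q^2+q+1 .$$
   Context: $\mathbb{P}^2(\mathbb{F}_q)$ is the projective plane over the field $\mathbb{F}_q$ with $q$ elements. A $k$-arc is a set of $k$ points of $\mathbb{P}^2(\mathbb{F}_q)$ no three of which are collinear. A conic is the zero set in $\mathbb{P}^2(\mathbb{F}_q)$ of a nonzero homogeneous quadratic form over $\mathbb{F}_q$. A Veronesian $k$-arc is a $k$-arc such that no six of its points lie on a conic. It is complete if it is not contained in a Veronesian $(k+1)$-arc. $t_v(2,q)$ is the size of the smallest complete Veronesian $k$-arc in $\mathbb{P}^2(\mathbb{F}_q)$. For real $t$ and an integer $j\ge 0$, $\binom{t}{j}=t(t-1)\cdots(t-j+1)/j!$. *)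

theory Defs
  imports "HOL-Analysis.Analysis"
begin

definition proj_points :: "('a::{field,finite} ^ 3) set set" where
  "proj_points = {P. vec.subspace P \<and> vec.dim P = 1}"

text \<open>The type of lines is not needed: a set of points is collinear if all of them are
  contained in a common two-dimensional subspace of the coordinate space.\<close>

definition proj_collinear :: "('a::{field,finite} ^ 3) set set \<Rightarrow> bool" where
  "proj_collinear S \<longleftrightarrow> (\<exists>L. vec.subspace L \<and> vec.dim L = 2 \<and> (\<forall>P\<in>S. P \<subseteq> L))"

text \<open>Quadratic forms are given by their six coefficients rather than by a symmetric matrix, so that
  characteristic two is treated correctly; being nonzero refers to the coefficients.\<close>

definition quad_form ::
  "'a::{field,finite} \<Rightarrow> 'a \<Rightarrow> 'a \<Rightarrow> 'a \<Rightarrow> 'a \<Rightarrow> 'a \<Rightarrow> 'a ^ 3 \<Rightarrow> 'a" where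
  "quad_form a b c d e f v =
     a * (v $ 1)\<^sup>2 + b * (v $ 2)\<^sup>2 + c * (v $ 3)\<^sup>2
     + d * (v $ 1) * (v $ 2) + e * (v $ 1) * (v $ 3) + f * (v $ 2) * (v $ 3)"

definition conic :: "('a::{field,finite} ^ 3) set set \<Rightarrow> bool" where
  "conic C \<longleftrightarrow> (\<exists>a b c d e f. (a, b, c, d, e, f) \<noteq> (0, 0, 0, 0, 0, 0) \<and>
     C = {P \<in> proj_points. \<forall>v\<in>P. quad_form a b c d e f v = 0})"

definition arc :: "nat \<Rightarrow> ('a::{field,finite} ^ 3) set set \<Rightarrow> bool" where
  "arc k K \<longleftrightarrow> K \<subseteq> proj_points \<and> card K = k \<and>
     (\<forall>T. T \<subseteq> K \<and> card T = 3 \<longrightarrow> \<not> proj_collinear T)"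

definition veronesian_arc :: "nat \<Rightarrow> ('a::{field,finite} ^ 3) set set \<Rightarrow> bool" where
  "veronesian_arc k K \<longleftrightarrow> arc k K \<and>
     (\<forall>T. T \<subseteq> K \<and> card T = 6 \<longrightarrow> \<not> (\<exists>C. conic C \<and> T \<subseteq> C))"

definition complete_veronesian_arc :: "nat \<Rightarrow> ('a::{field,finite} ^ 3) set set \<Rightarrow> bool" where
  "complete_veronesian_arc k K \<longleftrightarrow> veronesian_arc k K \<and>
     \<not> (\<exists>K'. veronesian_arc (k + 1) K' \<and> K \<subseteq> K')"

text \<open>The least element exists: the plane is finite and the empty set is a Veronesian 0-arc, so some
  Veronesian arc is maximal. The value depends only on the number of elements of the field.\<close>

definition t_v :: "'a::{field,finite} itself \<Rightarrow> nat" where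
  "t_v _ = (LEAST k. \<exists>K :: ('a ^ 3) set set. complete_veronesian_arc k K)"

end

theory Submission
  imports Defs
begin

text \<open>Let \<open>K\<close> be a complete Veronesian arc with \<open>k\<close> points. Adding a point \<open>P\<close> outside \<open>K\<close>
  destroys the defining property, and a violation must involve \<open>P\<close>: either \<open>P\<close> is collinear with two
  points of \<open>K\<close>, or \<open>P\<close> lies on a conic with five points of \<open>K\<close>
  (\<open>complete_veronesian_arc_covers\<close>). The line through two points has \<open>q - 1\<close> further points
  (\<open>card_other_points_on_line\<close>). Five points of an arc determine one conic, which is
  irreducible and has \<open>q - 4\<close> further points (\<open>card_other_points_on_conics\<close>). As the plane has
  \<open>q\<^sup>2 + q + 1\<close> points, the union bound over the pairs and the 5-subsets of \<open>K\<close> says that \<open>k\<close>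
  itself satisfies the inequality (\<open>complete_veronesian_arc_counting_bound\<close>), so the least
  positive real solution is at most \<open>k\<close>.

  The bound for conics is the substantial part. In homogeneous coordinates \<open>x, y, z\<close> whose
  reference triangle is formed by three of the five points, a conic through the three has the equation
  \<open>d x y + e x z + f y z = 0\<close>. Dividing by \<open>x y\<close> gives \<open>d + e t + f s = 0\<close> with \<open>t = z / y\<close> and
  \<open>s = z / x\<close>: the quadratic Cremona transformation turns the conic into a line, and this line is
  determined by the images of the two remaining points. A point of the conic is thus determined by
  its parameter \<open>t\<close>, and four values of \<open>t\<close> are excluded for the points other than the given five.
  Uniqueness and irreducibility of the conic come out of this computation.\<close>

section \<open>Points and lines in homogeneous coordinates\<close>

lemma proj_point_span: "a \<noteq> 0 \<Longrightarrow> vec.span {a} \<in> proj_points"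
  unfolding proj_points_def
  using vec.dim_span_eq_card_independent[of "{a}"] by auto

lemma proj_pointE:
  assumes "P \<in> proj_points"
  obtains a where "a \<noteq> 0" "P = vec.span {a}"
proof -
  obtain B where B: "B \<subseteq> P" "vec.independent B" "P \<subseteq> vec.span B" "card B = 1"
    using assms vec.basis_exists[of P] unfolding proj_points_def by auto
  then obtain a where a: "B = {a}" by (meson card_1_singletonE)
  have "vec.subspace P" using assms by (simp add: proj_points_def)
  then have "vec.span B \<subseteq> P" using B(1) by (simp add: vec.span_minimal)
  then show thesis using that[of a] B a by auto
qed

lemma mem_span_singleton: "x \<in> vec.span {a} \<longleftrightarrow> (\<exists>k. x = k *s a)"
  by (auto simp: vec.span_singleton)

lemma mem_span_pair: "x \<in> vec.span {a, b} \<longleftrightarrow> (\<exists>k l. x = k *s a + l *s b)"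
  by (simp add: vec.span_breakdown_eq[of x a "{b}"] mem_span_singleton)
     (metis add.commute diff_add_cancel add_diff_cancel_left')

lemma span_singleton_scale:
  fixes a :: "'a::field ^ 3"
  assumes "k \<noteq> 0"
  shows "vec.span {k *s a} = vec.span {a}"
proof -
  have "a = inverse k *s (k *s a)" using assms by simp
  then have "a \<in> vec.span {k *s a}" unfolding mem_span_singleton by blast
  moreover have "k *s a \<in> vec.span {a}" unfolding mem_span_singleton by blast
  ultimately show ?thesis
    by (intro subset_antisym vec.span_minimal) auto
qed

lemma span_singleton_eqI:
  fixes a :: "'a::field ^ 3"
  assumes "b \<in> vec.span {a}" "b \<noteq> 0"
  shows "vec.span {b} = vec.span {a}"
  using assms span_singleton_scale unfolding mem_span_singleton by (metis vec.scale_eq_0_iff)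

lemma independent_pair:
  fixes a b :: "'a::field ^ 3"
  assumes "a \<noteq> 0" "b \<noteq> 0" "vec.span {a} \<noteq> vec.span {b}"
  shows "vec.independent {a, b}" "a \<noteq> b"
proof -
  have "a \<notin> vec.span {b}" using assms span_singleton_eqI by blast
  moreover have "vec.independent {b}" using assms by simp
  ultimately show "vec.independent {a, b}" by (rule vec.independent_insertI)
  show "a \<noteq> b" using assms by auto
qed

text \<open>Collinearity asks for a common subspace of dimension exactly two. For two distinct points
  the span of their representatives is the only candidate.\<close>

lemma collinear_iff_mem_span:
  fixes a b c :: "'a::{field,finite} ^ 3"
  assumes "a \<noteq> 0" "b \<noteq> 0" "vec.span {a} \<noteq> vec.span {b}"
  shows "proj_collinear {vec.span {a}, vec.span {b}, vec.span {c}} \<longleftrightarrow> c \<in> vec.span {a, b}"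
proof
  have dim: "vec.dim (vec.span {a, b}) = 2"
    using vec.dim_span_eq_card_independent[OF independent_pair(1)[OF assms]]
      independent_pair(2)[OF assms] by simp
  {
    assume c: "c \<in> vec.span {a, b}"
    have "vec.span {x} \<subseteq> vec.span {a, b}" if "x \<in> {a, b, c}" for x
      using that c by (intro vec.span_minimal) (auto intro: vec.span_base)
    then show "proj_collinear {vec.span {a}, vec.span {b}, vec.span {c}}"
      unfolding proj_collinear_def using dim by (intro exI[of _ "vec.span {a, b}"]) auto
  next
    assume "proj_collinear {vec.span {a}, vec.span {b}, vec.span {c}}"
    then obtain L where L: "vec.subspace L" "vec.dim L = 2"
      and "vec.span {a} \<subseteq> L" "vec.span {b} \<subseteq> L" "vec.span {c} \<subseteq> L"
      unfolding proj_collinear_def by auto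
    then have "a \<in> L" "b \<in> L" "c \<in> L" using vec.span_base by blast+
    then have "vec.span {a, b} \<subseteq> L" using L(1) by (intro vec.span_minimal) auto
    then have "vec.span {a, b} = L" using L dim by (intro vec.subspace_dim_equal) auto
    then show "c \<in> vec.span {a, b}" using \<open>c \<in> L\<close> by simp
  }
qed

text \<open>Apart from the points spanned by \<open>a\<close> and \<open>b\<close>, the line that joins them consists of the points
  spanned by \<open>a + t b\<close> with \<open>t \<noteq> 0\<close>.\<close>

lemma card_other_points_on_line:
  fixes T :: "('a::{field,finite} ^ 3) set set"
  assumes T: "T \<subseteq> proj_points" "card T = 2"
  shows "card {P \<in> proj_points - T. proj_collinear (insert P T)} \<le> CARD('a) - 1"
    (is "card ?W \<le> _")
proof -
  obtain A B where AB: "T = {A, B}" "A \<noteq> B" using T(2) by (auto simp: card_2_iff)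
  have "A \<in> proj_points" "B \<in> proj_points" using T(1) AB(1) by auto
  then obtain a b where a: "a \<noteq> 0" "A = vec.span {a}" and b: "b \<noteq> 0" "B = vec.span {b}"
    by (elim proj_pointE)
  have "?W \<subseteq> (\<lambda>t. vec.span {a + t *s b}) ` (UNIV - {0})"
  proof
    fix P assume P: "P \<in> ?W"
    then obtain p where p: "p \<noteq> 0" "P = vec.span {p}" using proj_pointE by blast
    have "P \<noteq> A" "P \<noteq> B" "proj_collinear {A, B, P}" using P AB(1) by (auto simp: insert_commute)
    then have not_axis: "p \<notin> vec.span {a}" "p \<notin> vec.span {b}"
      and "proj_collinear {vec.span {a}, vec.span {b}, vec.span {p}}"
      using p a b span_singleton_eqI by metis+
    moreover have "vec.span {a} \<noteq> vec.span {b}" using a b AB(2) by simp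
    ultimately have "p \<in> vec.span {a, b}"
      using collinear_iff_mem_span[OF a(1) b(1)] by blast
    then obtain k l where kl: "p = k *s a + l *s b" unfolding mem_span_pair by blast
    have "k \<noteq> 0" "l \<noteq> 0" using not_axis kl by (auto simp: mem_span_singleton)
    have "p = k *s (a + (l / k) *s b)"
      using kl \<open>k \<noteq> 0\<close> by simp
    then have "P = vec.span {a + (l / k) *s b}"
      using p span_singleton_scale[OF \<open>k \<noteq> 0\<close>] by metis
    then show "P \<in> (\<lambda>t. vec.span {a + t *s b}) ` (UNIV - {0})"
      using \<open>k \<noteq> 0\<close> \<open>l \<noteq> 0\<close> by (intro image_eqI[of _ _ "l / k"]) auto
  qed
  then have "card ?W \<le> card (UNIV - {0 :: 'a})" by (rule surj_card_le[rotated]) simp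
  also have "\<dots> = CARD('a) - 1" by (simp add: card_Diff_subset)
  finally show ?thesis .
qed

text \<open>The points partition the \<open>q\<^sup>3 - 1\<close> nonzero vectors into classes of \<open>q - 1\<close> proportional ones. The
  covering argument needs many points, so only the lower bound is derived.\<close>

lemma card_proj_points_ge:
  "CARD('a)^2 + CARD('a) + 1 \<le> card (proj_points :: ('a::{field,finite} ^ 3) set set)"
    (is "_ \<le> card ?\<P>")
proof -
  let ?q = "CARD('a)"
  have q: "?q \<ge> 2"
    using card_mono[of UNIV "{0, 1 :: 'a}"] by simp
  have "UNIV - {0} \<subseteq> (\<Union>P\<in>?\<P>. P - {0})"
    using proj_point_span vec.span_base by blast
  then have "card (UNIV - {0 :: 'a ^ 3}) \<le> card (\<Union>P\<in>?\<P>. P - {0})" by (intro card_mono) auto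
  also have "\<dots> \<le> (\<Sum>P\<in>?\<P>. card (P - {0}))" by (rule card_UN_le) simp
  also have "\<dots> \<le> (\<Sum>P\<in>?\<P>. ?q - 1)"
  proof (rule sum_mono)
    fix P assume "P \<in> ?\<P>"
    then obtain a where a: "a \<noteq> 0" "P = vec.span {a}" using proj_pointE by blast
    have "P - {0} \<subseteq> (\<lambda>k. k *s a) ` (UNIV - {0})"
      unfolding a(2) vec.span_singleton by auto
    then have "card (P - {0}) \<le> card (UNIV - {0 :: 'a})" by (rule surj_card_le[rotated]) simp
    then show "card (P - {0}) \<le> ?q - 1" by (simp add: card_Diff_subset)
  qed
  finally have "?q ^ 3 - 1 \<le> card ?\<P> * (?q - 1)" by (simp add: card_Diff_subset CARD_vec)
  moreover have "?q ^ 3 - 1 = (?q^2 + ?q + 1) * (?q - 1)"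
    using q by (cases ?q) (auto simp: algebra_simps power2_eq_square power3_eq_cube)
  ultimately have "(?q^2 + ?q + 1) * (?q - 1) \<le> card ?\<P> * (?q - 1)" by (simp only:)
  then show ?thesis using q by (subst (asm) mult_le_cancel2) auto
qed

section \<open>Conics through five points\<close>

text \<open>A quadratic form is the sum of its diagonal part and its polar form, in every characteristic. If
  it vanishes at \<open>u\<close> and \<open>v\<close>, its polar form at \<open>(u, v)\<close> is the value at \<open>u + v\<close>; this gives the
  coefficients with respect to a frame of zeros without a change of basis for the form.\<close>

lemma quad_form_frame:
  fixes u v w :: "'a::{field,finite} ^ 3"
  assumes "quad_form a b c d e f u = 0" "quad_form a b c d e f v = 0" "quad_form a b c d e f w = 0"
  defines "B \<equiv> \<lambda>u v. quad_form a b c d e f (u + v)"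
  shows "quad_form a b c d e f (x *s u + y *s v + z *s w) = x * y * B u v + x * z * B u w + y * z * B v w"
proof -
  let ?Q = "quad_form a b c d e f"
  have "?Q (x *s u + y *s v + z *s w) = x^2 * ?Q u + y^2 * ?Q v + z^2 * ?Q w
     + x * y * (?Q (u + v) - ?Q u - ?Q v) + x * z * (?Q (u + w) - ?Q u - ?Q w)
     + y * z * (?Q (v + w) - ?Q v - ?Q w)"
    unfolding quad_form_def by (simp add: algebra_simps power2_eq_square)
  then show ?thesis using assms by simp
qed

lemma quad_form_eq_0_imp_coeffs:
  fixes a :: "'a::{field,finite}"
  assumes "\<And>v. quad_form a b c d e f v = 0"
  shows "(a, b, c, d, e, f) = (0, 0, 0, 0, 0, 0)"
proof -
  have *: "a * x^2 + b * y^2 + c * z^2 + d * x * y + e * x * z + f * y * z = 0" for x y z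
    using assms[of "vector [x, y, z]"] by (simp add: quad_form_def)
  have "a = 0" "b = 0" "c = 0" using *[of 1 0 0] *[of 0 1 0] *[of 0 0 1] by auto
  then show ?thesis using *[of 1 1 0] *[of 1 0 1] *[of 0 1 1] by auto
qed

lemma coordinates_in_frame:
  fixes u v w :: "'a::field ^ 3"
  assumes "u \<noteq> 0" "v \<noteq> 0" "vec.span {u} \<noteq> vec.span {v}" "w \<notin> vec.span {u, v}"
  obtains x y z where "p = x *s u + y *s v + z *s w"
proof -
  have "vec.independent {w, u, v}"
    using vec.independent_insertI[OF assms(4) independent_pair(1)[OF assms(1-3)]] .
  moreover have "card {w, u, v} = 3"
  proof -
    have "w \<notin> {u, v}" using assms(4) vec.span_base by blast
    then show ?thesis using independent_pair(2)[OF assms(1-3)] by simp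
  qed
  ultimately have "UNIV \<subseteq> vec.span {w, u, v}"
    by (intro vec.card_ge_dim_independent) (auto simp: vec_dim_card simp del: vec.dim_UNIV)
  then have "p \<in> vec.span {w, u, v}" by auto
  then obtain z where "p - z *s w \<in> vec.span {u, v}" unfolding vec.span_breakdown_eq[of p w] by blast
  then obtain x y where "p - z *s w = x *s u + y *s v" unfolding mem_span_pair by blast
  then show thesis using that[of x y z] by (simp add: algebra_simps)
qed

text \<open>The condition \<open>s4 t5 \<noteq> s5 t4\<close> says that the line through the two points avoids the origin, and
  the other two say that it is parallel to no axis; so no coefficient of its equation vanishes, and
  \<open>s\<close> is a function of \<open>t\<close> along it with slope \<open>m\<close>. The slope depends on the two points only, so all
  the equations \<open>(d, e, f)\<close> define the same line: this is the uniqueness of the conic through five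
  points.\<close>

lemma line_through_two_affine_points:
  fixes s4 t4 s5 t5 :: "'a::field"
  assumes "t4 \<noteq> t5" "s4 \<noteq> s5" "s4 * t5 \<noteq> s5 * t4" "(d, e, f) \<noteq> (0, 0, 0)"
    and 4: "d + e * t4 + f * s4 = 0" and 5: "d + e * t5 + f * s5 = 0"
  defines "m \<equiv> (s5 - s4) / (t5 - t4)"
  shows "d \<noteq> 0" "e \<noteq> 0" "f \<noteq> 0"
    and "\<And>s t. d + e * t + f * s = 0 \<Longrightarrow> s = s4 + m * (t - t4)"
proof -
  have e: "e * (t5 - t4) = - f * (s5 - s4)" using 4 5 by algebra
  show f: "f \<noteq> 0"
    using e assms(1,4) 4 by auto
  show "e \<noteq> 0" using e f assms(2) by auto
  have "d * (t5 - t4) = - f * (s4 * t5 - s5 * t4)" using 4 5 by algebra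
  then show "d \<noteq> 0" using f assms(1,3) by auto
  fix s t assume st: "d + e * t + f * s = 0"
  have "f * ((s - s4) * (t5 - t4)) = f * ((s5 - s4) * (t - t4))" using 4 5 st by algebra
  then have "(s - s4) * (t5 - t4) = (s5 - s4) * (t - t4)" using f by simp
  then show "s = s4 + m * (t - t4)"
    unfolding m_def using assms(1) by (simp add: divide_simps) (simp add: algebra_simps)
qed

text \<open>Inverse of the Cremona transformation: a point off the line \<open>z = 0\<close> is recovered from the values
  \<open>s = z / x\<close> and \<open>t = z / y\<close>. As \<open>z / 0 = 0\<close> and \<open>inverse 0 = 0\<close>, this includes the points with
  \<open>x = 0\<close> or \<open>y = 0\<close>.\<close>

lemma span_normalise_last_coordinate:
  fixes u v w :: "'a::field ^ 3"
  assumes "z \<noteq> 0"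
  shows "vec.span {x *s u + y *s v + z *s w} =
    vec.span {inverse (z / x) *s u + inverse (z / y) *s v + w}"
proof -
  have "x *s u + y *s v + z *s w = z *s (inverse (z / x) *s u + inverse (z / y) *s v + w)"
    using assms by simp
  then show ?thesis using span_singleton_scale[OF assms] by metis
qed

text \<open>Two points whose last two coordinates are proportional lie on a line through the first reference
  point. Contrapositively, noncollinearity becomes the nonvanishing of a \<open>2 \<times> 2\<close> minor.\<close>

lemma proportional_imp_mem_span:
  fixes u v w :: "'a::field ^ 3"
  assumes "y \<noteq> 0" "y * z' = y' * z"
  shows "x' *s u + y' *s v + z' *s w \<in> vec.span {u, x *s u + y *s v + z *s w}"
proof -
  define k where "k = y' / y"
  have "y' = k * y" "z' = k * z" using assms by (auto simp: k_def field_simps)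
  then have "x' *s u + y' *s v + z' *s w = (x' - k * x) *s u + k *s (x *s u + y *s v + z *s w)"
    by (simp add: vec_eq_iff algebra_simps)
  then show ?thesis unfolding mem_span_pair by blast
qed

text \<open>The five points are \<open>A1, A2, A3\<close>, which form the reference triangle, and \<open>A4, A5\<close>, which fix the
  line \<open>s = s4 + m (t - t4)\<close>. For a further point of the conic the parameter \<open>t\<close> differs from \<open>0\<close>, from
  the parameters \<open>t4\<close> and \<open>t5\<close> of \<open>A4\<close> and \<open>A5\<close>, and from the zero \<open>t0\<close> of \<open>s\<close>, because such a point
  is on no side of the triangle. These four values are distinct, so \<open>q - 4\<close> parameters remain.\<close>

lemma card_other_points_on_conics:
  fixes T :: "('a::{field,finite} ^ 3) set set"
  assumes T: "arc 5 T"
  shows "card {P \<in> proj_points - T. \<exists>C. conic C \<and> insert P T \<subseteq> C} \<le> CARD('a) - 4"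
    (is "card ?W \<le> _")
proof -
  have "card T = 5" and Tp: "T \<subseteq> proj_points"
    and nc: "\<And>U. U \<subseteq> T \<Longrightarrow> card U = 3 \<Longrightarrow> \<not> proj_collinear U"
    using T by (auto simp: arc_def)
  obtain Ps where Ps: "set Ps = T" "distinct Ps" using finite_distinct_list[of T] by auto
  then have "length Ps = 5" using \<open>card T = 5\<close> distinct_card by fastforce
  then obtain A1 A2 A3 A4 A5 where "Ps = [A1, A2, A3, A4, A5]"
    by (auto simp: length_Suc_conv eval_nat_numeral)
  then have T_eq: "T = {A1, A2, A3, A4, A5}" and "distinct [A1, A2, A3, A4, A5]"
    using Ps by auto
  have Ap: "A1 \<in> proj_points" "A2 \<in> proj_points" "A3 \<in> proj_points" "A4 \<in> proj_points"
    "A5 \<in> proj_points" using Tp T_eq by auto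
  obtain a1 where a1: "a1 \<noteq> 0" "A1 = vec.span {a1}" using Ap(1) by (rule proj_pointE)
  obtain a2 where a2: "a2 \<noteq> 0" "A2 = vec.span {a2}" using Ap(2) by (rule proj_pointE)
  obtain a3 where a3: "a3 \<noteq> 0" "A3 = vec.span {a3}" using Ap(3) by (rule proj_pointE)
  obtain a4 where a4: "a4 \<noteq> 0" "A4 = vec.span {a4}" using Ap(4) by (rule proj_pointE)
  obtain a5 where a5: "a5 \<noteq> 0" "A5 = vec.span {a5}" using Ap(5) by (rule proj_pointE)
  note a = a1(2) a2(2) a3(2) a4(2) a5(2) and a0 = a1(1) a2(1) a3(1) a4(1) a5(1)
  have dist: "distinct [vec.span {a1}, vec.span {a2}, vec.span {a3}, vec.span {a4}, vec.span {a5}]"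
    using \<open>distinct [A1, A2, A3, A4, A5]\<close> a by simp
  have Ta: "T = {vec.span {a1}, vec.span {a2}, vec.span {a3}, vec.span {a4}, vec.span {a5}}"
    using T_eq a by simp
  then have memT: "vec.span {a1} \<in> T" "vec.span {a2} \<in> T" "vec.span {a3} \<in> T"
    "vec.span {a4} \<in> T" "vec.span {a5} \<in> T" by simp_all
  have notin: "w \<notin> vec.span {u, v}"
    if "u \<noteq> 0" "v \<noteq> 0" "{vec.span {u}, vec.span {v}, vec.span {w}} \<subseteq> T"
      "distinct [vec.span {u}, vec.span {v}, vec.span {w}]" for u v w
    using that collinear_iff_mem_span[of u v w] nc[of "{vec.span {u}, vec.span {v}, vec.span {w}}"] by simp
  have coords: "\<exists>x y z. p = x *s a1 + y *s a2 + z *s a3" for p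
  proof -
    have "vec.span {a1} \<noteq> vec.span {a2}" using dist by simp
    moreover have "a3 \<notin> vec.span {a1, a2}" by (rule notin) (use a0 dist memT in simp_all)
    ultimately show ?thesis using a0 coordinates_in_frame[of a1 a2 a3 p] by metis
  qed
  have nonzero: "x \<noteq> 0 \<and> y \<noteq> 0 \<and> z \<noteq> 0"
    if "w = x *s a1 + y *s a2 + z *s a3" "w \<noteq> 0" "vec.span {w} \<in> T"
      "\<forall>u\<in>{a1, a2, a3}. vec.span {u} \<noteq> vec.span {w}" for x y z w
  proof -
    have "w \<notin> vec.span {a2, a3}" "w \<notin> vec.span {a1, a3}" "w \<notin> vec.span {a1, a2}"
      by (rule notin; use that(2-4) a0 dist memT in simp)+
    moreover have "w \<in> vec.span {a2, a3}" if "x = 0"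
      using \<open>w = _\<close> that by (auto simp: mem_span_pair)
    moreover have "w \<in> vec.span {a1, a3}" if "y = 0"
      using \<open>w = _\<close> that by (auto simp: mem_span_pair)
    moreover have "w \<in> vec.span {a1, a2}" if "z = 0"
      using \<open>w = _\<close> that by (auto simp: mem_span_pair)
    ultimately show ?thesis by blast
  qed
  obtain x4 y4 z4 where a4_eq: "a4 = x4 *s a1 + y4 *s a2 + z4 *s a3" using coords by blast
  obtain x5 y5 z5 where a5_eq: "a5 = x5 *s a1 + y5 *s a2 + z5 *s a3" using coords by blast
  have nz: "x4 \<noteq> 0" "y4 \<noteq> 0" "z4 \<noteq> 0" "x5 \<noteq> 0" "y5 \<noteq> 0" "z5 \<noteq> 0"
    using nonzero[OF a4_eq] nonzero[OF a5_eq] a0 dist memT by simp_all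
  have na5: "a5 \<notin> vec.span {a1, a4}" "a5 \<notin> vec.span {a2, a4}" "a5 \<notin> vec.span {a3, a4}"
    by (rule notin; use a0 dist memT in simp)+
  \<comment> \<open>The minors are nonzero because the line joining \<open>A4\<close> and \<open>A5\<close> misses \<open>A1\<close>, \<open>A2\<close>, \<open>A3\<close>.\<close>
  have ne1: "y4 * z5 \<noteq> y5 * z4"
    using na5(1) proportional_imp_mem_span[of y4 z5 y5 z4 x5 a1 a2 a3 x4] nz a4_eq a5_eq by auto
  have ne2: "x4 * z5 \<noteq> x5 * z4"
    using na5(2) proportional_imp_mem_span[of x4 z5 x5 z4 y5 a2 a1 a3 y4] nz a4_eq a5_eq
    by (auto simp: add_ac)
  have ne3: "x4 * y5 \<noteq> x5 * y4"
    using na5(3) proportional_imp_mem_span[of x4 y5 x5 y4 z5 a3 a1 a2 z4] nz a4_eq a5_eq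
    by (auto simp: add_ac)
  define s4 t4 s5 t5 where st: "s4 = z4 / x4" "t4 = z4 / y4" "s5 = z5 / x5" "t5 = z5 / y5"
  have st_nz: "s4 \<noteq> 0" "t4 \<noteq> 0" "s5 \<noteq> 0" "t5 \<noteq> 0" using nz by (auto simp: st)
  have st_ne: "t4 \<noteq> t5" "s4 \<noteq> s5" "s4 * t5 \<noteq> s5 * t4"
    using nz ne1 ne2 ne3 by (auto simp: st field_simps)
  define m where "m = (s5 - s4) / (t5 - t4)"
  have "m \<noteq> 0" using st_ne by (simp add: m_def)
  define t0 where "t0 = t4 - s4 / m"
  define g where "g t = vec.span {inverse (s4 + m * (t - t4)) *s a1 + inverse t *s a2 + a3}" for t
  have s5: "s5 = s4 + m * (t5 - t4)" using st_ne by (simp add: m_def)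
  have s0: "s4 + m * (t0 - t4) = 0" using \<open>m \<noteq> 0\<close> by (simp add: t0_def)
  have t0_ne: "t0 \<noteq> t4" "t0 \<noteq> t5" using s0 s5 st_nz by auto
  have "t0 \<noteq> 0"
  proof
    assume "t0 = 0"
    then have "s4 = m * t4" using s0 by simp
    then show False using s5 st_ne(3) by (simp add: algebra_simps)
  qed
  have card4: "card {0, t4, t5, t0} = 4" using st_nz st_ne t0_ne \<open>t0 \<noteq> 0\<close> by auto
  have g4: "g t4 = A4"
    using span_normalise_last_coordinate[OF nz(3), of x4 a1 y4 a2 a3] a4_eq a4
    by (simp add: g_def st)
  have g5: "g t5 = A5"
    using span_normalise_last_coordinate[OF nz(6), of x5 a1 y5 a2 a3] a5_eq a5
    unfolding g_def s5[symmetric] by (simp add: st)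
  have "?W \<subseteq> g ` (UNIV - {0, t4, t5, t0})"
  proof
    fix P assume P: "P \<in> ?W"
    then obtain p where p: "p \<noteq> 0" "P = vec.span {p}" using proj_pointE by blast
    obtain c1 c2 c3 c4 c5 c6 where c: "(c1, c2, c3, c4, c5, c6) \<noteq> (0, 0, 0, 0, 0, 0)"
      and Q: "\<forall>R\<in>insert P T. \<forall>v\<in>R. quad_form c1 c2 c3 c4 c5 c6 v = 0"
    proof -
      obtain C where "conic C" and C: "insert P T \<subseteq> C" using P by blast
      then obtain c1 c2 c3 c4 c5 c6 where coeffs: "(c1, c2, c3, c4, c5, c6) \<noteq> (0, 0, 0, 0, 0, 0)"
        and C_eq: "C = {P \<in> proj_points. \<forall>v\<in>P. quad_form c1 c2 c3 c4 c5 c6 v = 0}"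
        unfolding conic_def by blast
      show thesis by (rule that[OF coeffs]) (use C C_eq in blast)
    qed
    let ?Q = "quad_form c1 c2 c3 c4 c5 c6"
    have "?Q v = 0" if "vec.span {v} \<in> insert P T" for v
      using Q that vec.span_base[of v "{v}"] by blast
    then have Q0: "?Q a1 = 0" "?Q a2 = 0" "?Q a3 = 0" "?Q a4 = 0" "?Q a5 = 0" "?Q p = 0"
      using memT p(2) by simp_all
    define d e f where def: "d = ?Q (a1 + a2)" "e = ?Q (a1 + a3)" "f = ?Q (a2 + a3)"
    have frame: "?Q (x *s a1 + y *s a2 + z *s a3) = x * y * d + x * z * e + y * z * f" for x y z
      unfolding def by (rule quad_form_frame[OF Q0(1-3)])
    have def0: "(d, e, f) \<noteq> (0, 0, 0)"
    proof
      assume "(d, e, f) = (0, 0, 0)"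
      then have "?Q v = 0" for v using coords[of v] frame by auto
      then show False using quad_form_eq_0_imp_coeffs c by blast
    qed
    have affine: "d + e * (z / y) + f * (z / x) = 0"
      if "x \<noteq> 0" "y \<noteq> 0" "?Q (x *s a1 + y *s a2 + z *s a3) = 0" for x y z
      using that unfolding frame by (simp add: field_simps)
    have on_line: "d + e * t4 + f * s4 = 0" "d + e * t5 + f * s5 = 0"
      using affine nz Q0(4,5) a4_eq a5_eq by (auto simp: st)
    have def_nz: "d \<noteq> 0" "e \<noteq> 0" "f \<noteq> 0"
      and line: "\<And>s t. d + e * t + f * s = 0 \<Longrightarrow> s = s4 + m * (t - t4)"
      using line_through_two_affine_points[OF st_ne def0 on_line] unfolding m_def by simp_all
    obtain x y z where p_eq: "p = x *s a1 + y *s a2 + z *s a3" using coords by blast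
    have not_axis: "p \<notin> vec.span {a1}" "p \<notin> vec.span {a2}" "p \<notin> vec.span {a3}"
    proof -
      have "vec.span {p} \<notin> T" using P p(2) by simp
      then show "p \<notin> vec.span {a1}" "p \<notin> vec.span {a2}" "p \<notin> vec.span {a3}"
        using memT(1-3) p(1) span_singleton_eqI by metis+
    qed
    have Qp: "x * y * d + x * z * e + y * z * f = 0" using Q0(6) frame p_eq by simp
    \<comment> \<open>On a side of the triangle the equation has only one nonzero term left, so the conic meets the
      side in vertices only.\<close>
    have xyz: "x \<noteq> 0" "y \<noteq> 0" "z \<noteq> 0"
      using not_axis Qp def_nz unfolding p_eq mem_span_singleton by auto
    have s_eq: "z / x = s4 + m * (z / y - t4)"
      using line affine[OF xyz(1,2)] Q0(6) p_eq by blast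
    then have Pg: "P = g (z / y)"
      using p p_eq span_normalise_last_coordinate[OF xyz(3), of x a1 y a2 a3] by (simp add: g_def)
    have "z / y \<noteq> 0" using xyz by simp
    moreover have "z / y \<noteq> t4" "z / y \<noteq> t5" using Pg g4 g5 P T_eq by auto
    moreover have "z / y \<noteq> t0" using s_eq s0 xyz by auto
    ultimately show "P \<in> g ` (UNIV - {0, t4, t5, t0})" using Pg by blast
  qed
  then have "card ?W \<le> card (UNIV - {0, t4, t5, t0})" by (rule surj_card_le[rotated]) simp
  also have "\<dots> = CARD('a) - 4" using card4 by (simp add: card_Diff_subset)
  finally show ?thesis .
qed

section \<open>Covering the plane\<close>

lemma complete_veronesian_arc_covers:
  fixes K :: "('a::{field,finite} ^ 3) set set"
  assumes K: "complete_veronesian_arc k K" and P: "P \<in> proj_points" "P \<notin> K"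
  shows "(\<exists>T\<subseteq>K. card T = 2 \<and> proj_collinear (insert P T)) \<or>
    (\<exists>T\<subseteq>K. card T = 5 \<and> (\<exists>C. conic C \<and> insert P T \<subseteq> C))"
proof -
  have V: "veronesian_arc k K" and not: "\<not> veronesian_arc (k + 1) (insert P K)"
    using K by (auto simp: complete_veronesian_arc_def)
  have nc: "\<not> proj_collinear T" if "T \<subseteq> K" "card T = 3" for T
    using V that by (auto simp: veronesian_arc_def arc_def)
  have ncon: "\<not> (\<exists>C. conic C \<and> T \<subseteq> C)" if "T \<subseteq> K" "card T = 6" for T
    using V that by (auto simp: veronesian_arc_def)
  have "insert P K \<subseteq> proj_points" "card (insert P K) = k + 1"
    using V P by (auto simp: veronesian_arc_def arc_def)
  then consider T where "T \<subseteq> insert P K" "card T = 3" "proj_collinear T"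
    | T C where "T \<subseteq> insert P K" "card T = 6" "conic C" "T \<subseteq> C"
    using not unfolding veronesian_arc_def arc_def by blast
  then show ?thesis
  proof cases
    case 1
    then have "P \<in> T" using nc by blast
    then have "T - {P} \<subseteq> K" "card (T - {P}) = 2" "insert P (T - {P}) = T" using 1 by auto
    then show ?thesis using 1 by metis
  next
    case 2
    then have "P \<in> T" using ncon by blast
    then have "T - {P} \<subseteq> K" "card (T - {P}) = 5" "insert P (T - {P}) = T" using 2 by auto
    then show ?thesis using 2 by metis
  qed
qed

lemma complete_veronesian_arc_counting_bound:
  fixes K :: "('a::{field,finite} ^ 3) set set"
  assumes K: "complete_veronesian_arc k K"
  shows "CARD('a)^2 + CARD('a) + 1 \<le>
    (k choose 5) * (CARD('a) - 4) + (k choose 2) * (CARD('a) - 1) + k"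
proof -
  let ?S = "\<lambda>n. {T. T \<subseteq> K \<and> card T = n}"
  let ?L = "\<lambda>T. {P \<in> proj_points - T. proj_collinear (insert P T)}"
  let ?C = "\<lambda>T. {P \<in> proj_points - T. \<exists>C. conic C \<and> insert P T \<subseteq> C}"
  have V: "arc k K" using K by (auto simp: complete_veronesian_arc_def veronesian_arc_def)
  then have Kp: "K \<subseteq> proj_points" and cK: "card K = k" by (auto simp: arc_def)
  have subset_arc: "arc (card T) T" if "T \<subseteq> K" for T using V that by (auto simp: arc_def)
  have "proj_points \<subseteq> \<Union> (?C ` ?S 5) \<union> \<Union> (?L ` ?S 2) \<union> K"
  proof
    fix P :: "('a ^ 3) set" assume P: "P \<in> proj_points"
    show "P \<in> \<Union> (?C ` ?S 5) \<union> \<Union> (?L ` ?S 2) \<union> K"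
    proof (cases "P \<in> K")
      case False
      from complete_veronesian_arc_covers[OF K P False] show ?thesis
        using P False by blast
    qed simp
  qed
  then have "card (proj_points :: ('a ^ 3) set set) \<le> card (\<Union> (?C ` ?S 5) \<union> \<Union> (?L ` ?S 2) \<union> K)"
    by (intro card_mono) auto
  also have "\<dots> \<le> card (\<Union> (?C ` ?S 5)) + card (\<Union> (?L ` ?S 2)) + k"
    using card_Un_le cK by (metis (no_types, lifting) add_mono order_refl order_trans)
  also have "card (\<Union> (?C ` ?S 5)) \<le> (\<Sum>T\<in>?S 5. card (?C T))" by (rule card_UN_le) simp
  also have "\<dots> \<le> (\<Sum>T\<in>?S 5. CARD('a) - 4)"
    using subset_arc by (intro sum_mono card_other_points_on_conics) force
  also have "\<dots> = (k choose 5) * (CARD('a) - 4)" using n_subsets[of K 5] cK by simp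
  also have "card (\<Union> (?L ` ?S 2)) \<le> (\<Sum>T\<in>?S 2. card (?L T))" by (rule card_UN_le) simp
  also have "\<dots> \<le> (\<Sum>T\<in>?S 2. CARD('a) - 1)"
    using Kp by (intro sum_mono card_other_points_on_line) auto
  also have "\<dots> = (k choose 2) * (CARD('a) - 1)" using n_subsets[of K 2] cK by simp
  finally show ?thesis using card_proj_points_ge[where ?'a = 'a] by simp
qed

lemma veronesian_arc_empty: "veronesian_arc 0 ({} :: ('a::{field,finite} ^ 3) set set)"
proof -
  have "card T \<noteq> 3" "card T \<noteq> 6" if "T \<subseteq> {}" for T :: "('a ^ 3) set set" using that by simp_all
  then show ?thesis unfolding veronesian_arc_def arc_def by (metis card.empty empty_subsetI)
qed

text \<open>Without a complete arc, \<open>t_v\<close> would be the \<open>LEAST\<close> of an empty set of sizes. A Veronesian arc of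
  greatest size is complete.\<close>

lemma complete_veronesian_arc_exists:
  "\<exists>k K. complete_veronesian_arc k (K :: ('a::{field,finite} ^ 3) set set)"
proof -
  let ?P = "\<lambda>k. \<exists>K :: ('a ^ 3) set set. veronesian_arc k K"
  have "?P 0" using veronesian_arc_empty by blast
  moreover have "\<forall>k. ?P k \<longrightarrow> k \<le> card (UNIV :: ('a ^ 3) set set)"
  proof (intro allI impI)
    fix k assume "?P k"
    then obtain K :: "('a ^ 3) set set" where "card K = k"
      unfolding veronesian_arc_def arc_def by blast
    then show "k \<le> card (UNIV :: ('a ^ 3) set set)" using card_mono[of UNIV K] by simp
  qed
  ultimately obtain k where k: "?P k" "\<forall>l. ?P l \<longrightarrow> l \<le> k"
    using Nat.ex_has_greatest_nat[of ?P 0] by blast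
  then have "\<not> ?P (k + 1)" by fastforce
  then show ?thesis using k(1) unfolding complete_veronesian_arc_def by blast
qed

section \<open>The least real solution\<close>

text \<open>The reals are not well-ordered, so \<open>LEAST\<close> is meaningful only if a minimum is attained. By
  continuity the solutions in \<open>{0..k}\<close> form a compact set, and its minimum is positive since \<open>0\<close> is
  not a solution.\<close>

lemma Least_real_superlevel_le:
  fixes f :: "real \<Rightarrow> real"
  assumes cont: "continuous_on UNIV f" and "f 0 < N" and k: "0 < k" "N \<le> f k"
  shows "(LEAST t. 0 < t \<and> N \<le> f t) \<le> k"
proof -
  define S where "S = {0..k} \<inter> {t. N \<le> f t}"
  have "closed {t. N \<le> f t}" using cont by (intro closed_Collect_le) auto
  then have "compact S" unfolding S_def by (intro compact_Int_closed) auto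
  moreover have "k \<in> S" using k by (simp add: S_def)
  ultimately obtain t where t: "t \<in> S" "\<And>s. s \<in> S \<Longrightarrow> t \<le> s"
    using compact_attains_inf[of S] by blast
  have "t \<noteq> 0" using t(1) \<open>f 0 < N\<close> by (auto simp: S_def)
  have "(LEAST t. 0 < t \<and> N \<le> f t) = t"
  proof (rule Least_equality)
    show "0 < t \<and> N \<le> f t" using t(1) \<open>t \<noteq> 0\<close> by (auto simp: S_def)
  next
    fix s assume s: "0 < s \<and> N \<le> f s"
    show "t \<le> s"
    proof (cases "s \<le> k")
      case True
      then show ?thesis using t(2)[of s] s by (simp add: S_def)
    next
      case False
      then show ?thesis using t(1) by (simp add: S_def)
    qed
  qed
  then show ?thesis using t(1) by (simp add: S_def)
qed

theorem theorem2:
  fixes q :: nat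
  assumes "CARD('a::{field,finite}) = q" and "q \<ge> 5"
  shows "int (t_v TYPE('a)) \<ge>
    \<lceil>LEAST t\<^sub>0::real. 0 < t\<^sub>0 \<and>
       (t\<^sub>0 gchoose 5) * (real q - 4) + (t\<^sub>0 gchoose 2) * (real q - 1) + t\<^sub>0
         \<ge> (real q)\<^sup>2 + real q + 1\<rceil>"
proof -
  define k where "k = t_v TYPE('a)"
  define f where "f t = (t gchoose 5) * (real q - 4) + (t gchoose 2) * (real q - 1) + t" for t :: real
  have "\<exists>K :: ('a ^ 3) set set. complete_veronesian_arc k K"
    unfolding k_def t_v_def using complete_veronesian_arc_exists by (rule LeastI_ex)
  then obtain K :: "('a ^ 3) set set" where "complete_veronesian_arc k K" by blast
  from complete_veronesian_arc_counting_bound[OF this]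
  have "q^2 + q + 1 \<le> (k choose 5) * (q - 4) + (k choose 2) * (q - 1) + k"
    unfolding assms(1) .
  then have "real (q^2 + q + 1) \<le> real ((k choose 5) * (q - 4) + (k choose 2) * (q - 1) + k)"
    by (rule of_nat_mono)
  then have fk: "(real q)\<^sup>2 + real q + 1 \<le> f (real k)"
    using assms(2) by (simp add: f_def binomial_gbinomial of_nat_diff)
  have f0: "f 0 = 0" by (simp add: f_def gbinomial_0_left)
  have pos: "0 < (real q)\<^sup>2 + real q + 1" by (simp add: add_nonneg_pos)
  have "0 < real k"
    using fk f0 pos by (cases "k = 0") auto
  moreover have "continuous_on UNIV f"
    unfolding f_def gbinomial_prod_rev by (intro continuous_intros) auto
  ultimately have "(LEAST t. 0 < t \<and> (real q)\<^sup>2 + real q + 1 \<le> f t) \<le> real k"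
    using fk f0 pos by (intro Least_real_superlevel_le) auto
  then show ?thesis unfolding f_def k_def by (simp add: ceiling_le_iff)
qed

end
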